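(* Let $\Phi\in[0,1]$. There is a distributed algorithm which does not receive the number of vertices as input and which, run on a connected graph $G=(V,E)$ with $n$ vertices and $m$ edges, computes $n$ (that is, makes $n$ known to all vertices) if $G$ has conductance at least $\Phi$; and if $G$ does not have conductance at least $\Phi$, it either computes $n$ or rejects. For $\Phi\in(0,1)$ its round complexity is $O(\log m/|\log(1-\Phi)|)$, asymptotically in $m$.
   Context: Graphs are finite, simple and undirected; $d(v)$ is the degree of $v$. Conductance. For $S\subseteq V$ let $\bar S=V\setminus S$, $\mathrm{vol}(S)=\sum_{v\in S}d(v)$, and let $E(S,\bar S)$ be the set of edges between $S$ and $\bar S$. For nonempty $S\subsetneq V$ with $\mathrm{vol}(S)\le\mathrm{vol}(\bar S)$, $\mathrm{cond}(S)=|E(S,\bar S)|/\mathrm{vol}(S)$. The conductance of $G$ is the minimum of $\mathrm{cond}(S)$ over all such $S$. Distributed model. Each vertex $v$ of $G$ is a processor, connected to its neighbors through ports numbered $1,\dots,d(v)$ by an arbitrary bijection to its neighbors. Computation proceeds in synchronized rounds; in each round, every vertex performs local computation, then sends a message of $O(\log n)$ bits to each neighbor, then receives the messages sent by its neighbors. Each vertex initially knows a unique numerical identifier of $O(\log n)$ bits and the parameter $\Phi$, but not $n$. One fixed vertex is marked; this vertex initiates the computation, and "the algorithm rejects" means that the marked vertex outputs reject. The round complexity is the number of rounds until termination. *)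

theory Defs
  imports Complex_Main "HOL-Library.Extended_Real"
begin

section \<open>Finite simple graphs and conductance\<close>

text \<open>A graph is given by its vertex set \<open>V\<close> and its set \<open>E\<close> of two-element edges. Vertices are
  natural numbers; these names are never visible to an algorithm.\<close>

definition simple_graph :: "nat set \<Rightarrow> nat set set \<Rightarrow> bool" where
  "simple_graph V E \<longleftrightarrow> finite V \<and> (\<forall>e\<in>E. e \<subseteq> V \<and> card e = 2)"

definition connected_graph :: "nat set \<Rightarrow> nat set set \<Rightarrow> bool" where
  "connected_graph V E \<longleftrightarrow>
     V \<noteq> {} \<and> (\<forall>u\<in>V. \<forall>v\<in>V. (u, v) \<in> {(x, y). {x, y} \<in> E}\<^sup>*)"

definition neighbors :: "nat set set \<Rightarrow> nat \<Rightarrow> nat set" where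
  "neighbors E v = {u. {v, u} \<in> E}"

definition degree :: "nat set set \<Rightarrow> nat \<Rightarrow> nat" where
  "degree E v = card (neighbors E v)"

definition vol :: "nat set set \<Rightarrow> nat set \<Rightarrow> nat" where
  "vol E S = (\<Sum>v\<in>S. degree E v)"

definition cut_edges :: "nat set \<Rightarrow> nat set set \<Rightarrow> nat set \<Rightarrow> nat set set" where
  "cut_edges V E S = {e. \<exists>u\<in>S. \<exists>v\<in>V - S. e = {u, v} \<and> e \<in> E}"

definition cond :: "nat set \<Rightarrow> nat set set \<Rightarrow> nat set \<Rightarrow> real" where
  "cond V E S = real (card (cut_edges V E S)) / real (vol E S)"

text \<open>The infimum ranges over finitely many sets and is a minimum as soon as \<open>V\<close> has two vertices.
  For a single vertex there is no admissible set, and the conductance is \<open>\<infinity>\<close>.\<close>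

definition conductance :: "nat set \<Rightarrow> nat set set \<Rightarrow> ereal" where
  "conductance V E =
     (INF S \<in> {S. S \<noteq> {} \<and> S \<subset> V \<and> vol E S \<le> vol E (V - S)}. ereal (cond V E S))"

section \<open>Networks\<close>

record network =
  verts :: "nat set"
  edges :: "nat set set"
  ident :: "nat \<Rightarrow> nat"
  port :: "nat \<Rightarrow> nat \<Rightarrow> nat"  \<comment> \<open>\<open>port N v i\<close> is the neighbor of \<open>v\<close> behind its port \<open>i\<close>\<close>
  marked :: nat

abbreviation deg :: "network \<Rightarrow> nat \<Rightarrow> nat" where
  "deg N v \<equiv> degree (edges N) v"

text \<open>The constant \<open>a\<close> is the one hidden in "identifiers of \<open>O(log n)\<close> bits": identifiers are
  below \<open>(2n)\<^sup>a\<close>, that is, they have at most \<open>a (1 + log\<^sub>2 n)\<close> bits. The factor 2 only matters for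
  \<open>n = 1\<close>.\<close>

definition valid_network :: "nat \<Rightarrow> network \<Rightarrow> bool" where
  "valid_network a N \<longleftrightarrow>
     simple_graph (verts N) (edges N) \<and>
     connected_graph (verts N) (edges N) \<and>
     (\<forall>v\<in>verts N. bij_betw (port N v) {1..deg N v} (neighbors (edges N) v)) \<and>
     inj_on (ident N) (verts N) \<and>
     (\<forall>v\<in>verts N. ident N v < (2 * card (verts N)) ^ a) \<and>
     marked N \<in> verts N"

section \<open>Synchronous message passing\<close>

datatype verdict = Count nat | Reject

text \<open>Local states are natural numbers. This is no restriction: a vertex can keep an encoding of its
  initial knowledge and of everything it has received, and local computation is unbounded.
  Messages are bit strings, the empty string standing for silence. A vertex starts from its
  identifier, its degree and the information whether it is marked. The local computation of a round
  is absorbed into the functions below. The verdict is \<open>None\<close> as long as a vertex has not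
  decided.\<close>

record algorithm =
  init :: "nat \<Rightarrow> nat \<Rightarrow> bool \<Rightarrow> nat"
  send :: "nat \<Rightarrow> nat \<Rightarrow> bool list"  \<comment> \<open>\<open>send A s i\<close> is sent through port \<open>i\<close> in state \<open>s\<close>\<close>
  receive :: "nat \<Rightarrow> (nat \<Rightarrow> bool list) \<Rightarrow> nat"
  verdict :: "nat \<Rightarrow> verdict option"

text \<open>\<open>run A N t v\<close> is the state of \<open>v\<close> after \<open>t\<close> rounds. What \<open>v\<close> receives through port \<open>i\<close> is what
  its neighbor \<open>u\<close> there sends through the port of \<open>u\<close> that leads to \<open>v\<close>.\<close>

primrec run :: "algorithm \<Rightarrow> network \<Rightarrow> nat \<Rightarrow> nat \<Rightarrow> nat" where
  "run A N 0 = (\<lambda>v. init A (ident N v) (deg N v) (v = marked N))"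
| "run A N (Suc t) = (\<lambda>v. receive A (run A N t v)
     (\<lambda>i. if i \<in> {1..deg N v}
          then let u = port N v i
               in send A (run A N t u) (inv_into {1..deg N u} (port N u) v)
          else []))"

definition idle :: "algorithm \<Rightarrow> nat \<Rightarrow> nat \<Rightarrow> bool" where
  "idle A d s \<longleftrightarrow> (\<forall>i\<in>{1..d}. send A s i = []) \<and> receive A s (\<lambda>_. []) = s"

text \<open>The marked vertex initiates the computation: every other vertex is silent and does not change
  its state before it is reached by a message.\<close>

definition initiated_by_marked :: "algorithm \<Rightarrow> bool" where
  "initiated_by_marked A \<longleftrightarrow> (\<forall>x d. idle A d (init A x d False))"

definition message_bound :: "real \<Rightarrow> algorithm \<Rightarrow> network \<Rightarrow> bool" where
  "message_bound c A N \<longleftrightarrow> (\<forall>t. \<forall>v\<in>verts N. \<forall>i\<in>{1..deg N v}.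
     real (length (send A (run A N t v) i)) \<le> c * log 2 (real (card (verts N))))"

text \<open>Without the next condition, a vertex could announce guesses and revise them, and so would not
  know \<open>n\<close>.\<close>

definition irrevocable :: "algorithm \<Rightarrow> network \<Rightarrow> bool" where
  "irrevocable A N \<longleftrightarrow> (\<forall>t. \<forall>v\<in>verts N. \<forall>x.
     verdict A (run A N t v) = Some x \<longrightarrow> verdict A (run A N (Suc t) v) = Some x)"

text \<open>If all vertices are idle, then no message is sent and no state changes ever after. One cannot
  ask every vertex to decide instead: after a rejection, vertices far from the marked one may never
  have been reached.\<close>

definition terminated :: "algorithm \<Rightarrow> network \<Rightarrow> nat \<Rightarrow> bool" where
  "terminated A N T \<longleftrightarrow> (\<forall>v\<in>verts N. idle A (deg N v) (run A N T v))"

definition computes_n :: "algorithm \<Rightarrow> network \<Rightarrow> bool" where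
  "computes_n A N \<longleftrightarrow> (\<exists>T. terminated A N T \<and>
     (\<forall>v\<in>verts N. verdict A (run A N T v) = Some (Count (card (verts N)))))"

definition rejects :: "algorithm \<Rightarrow> network \<Rightarrow> bool" where
  "rejects A N \<longleftrightarrow> (\<exists>T. terminated A N T \<and> verdict A (run A N T (marked N)) = Some Reject)"

text \<open>Used for terminating runs only.\<close>

definition rounds :: "algorithm \<Rightarrow> network \<Rightarrow> nat" where
  "rounds A N = (LEAST T. terminated A N T)"

end

theory Submission
  imports Defs "HOL-Library.Countable"
begin

text \<open>The marked vertex starts a breadth-first search whose frontier advances every second round.
  Along the resulting tree, every vertex passes on in each round the sum of the numbers that it has
  just received from its children, so the size of level \<open>d\<close> arrives at the marked vertex at time
  \<open>3 d\<close>. If level \<open>d\<close> is empty, the count is complete. If it is not empty and the \<open>b\<close> vertices seen up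
  to level \<open>d\<close> satisfy \<open>b\<^sup>4 (1 - \<Phi>)\<^bsup>d - 2\<^esup> < 1\<close>, the conductance is below \<open>\<Phi>\<close> and the marked vertex
  rejects. Either decision is flooded one level per round, hence overtakes the frontier after as
  many rounds as have already passed. A decision is made as soon as \<open>d\<close> exceeds
  \<open>2 + 4 ln n / \<bar>ln (1 - \<Phi>)\<bar>\<close>.

  The test is sound because a set \<open>S\<close> of at most half of the total volume has at least \<open>\<Phi> vol S\<close> cut
  edges, so that the vertices all of whose neighbors lie in \<open>S\<close> have volume at most
  \<open>(1 - \<Phi>) vol S\<close>. This applies to the balls around the marked vertex while they are small, and to
  their complements afterwards.\<close>

section \<open>Breadth-first levels\<close>

locale rooted_graph =
  fixes V :: "nat set" and E :: "nat set set" and r :: nat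
  assumes simple: "simple_graph V E" and connected: "connected_graph V E" and root_in: "r \<in> V"
begin

definition level :: "nat \<Rightarrow> nat" where
  "level v = (LEAST k. (r, v) \<in> {(x, y). {x, y} \<in> E} ^^ k)"

definition layer :: "nat \<Rightarrow> nat set" where
  "layer k = {v \<in> V. level v = k}"

definition ball :: "nat \<Rightarrow> nat set" where
  "ball k = {v \<in> V. level v \<le> k}"

lemma finite_V [simp]: "finite V"
  using simple by (simp add: simple_graph_def)

lemma edge_in: "{u, v} \<in> E \<Longrightarrow> u \<in> V \<and> v \<in> V \<and> u \<noteq> v"
  using simple unfolding simple_graph_def by force

lemma neighbors_sym: "u \<in> neighbors E v \<longleftrightarrow> v \<in> neighbors E u"
  by (simp add: neighbors_def insert_commute)

lemma neighbors_subset: "neighbors E v \<subseteq> V"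
  using edge_in by (auto simp: neighbors_def)

lemma finite_neighbors [simp]: "finite (neighbors E v)"
  using finite_subset[OF neighbors_subset] by simp

lemma reach_level: assumes "v \<in> V" shows "(r, v) \<in> {(x, y). {x, y} \<in> E} ^^ level v"
proof -
  have "\<exists>k. (r, v) \<in> {(x, y). {x, y} \<in> E} ^^ k"
    using connected assms root_in unfolding connected_graph_def rtrancl_power by blast
  then show ?thesis unfolding level_def by (rule LeastI_ex)
qed

lemma level_le: "(r, v) \<in> {(x, y). {x, y} \<in> E} ^^ k \<Longrightarrow> level v \<le> k"
  unfolding level_def by (rule Least_le)

lemma level_root [simp]: "level r = 0"
  using level_le[of r 0] by simp

lemma level_eq_0: "v \<in> V \<Longrightarrow> level v = 0 \<longleftrightarrow> v = r"
  using reach_level[of v] by auto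

lemma level_edge: assumes "{u, v} \<in> E" shows "level v \<le> Suc (level u)"
proof -
  have "(r, u) \<in> {(x, y). {x, y} \<in> E} ^^ level u"
    using reach_level edge_in[OF assms] by blast
  then have "(r, v) \<in> {(x, y). {x, y} \<in> E} ^^ Suc (level u)"
    using assms by auto
  then show ?thesis by (rule level_le)
qed

lemma level_neighbor:
  assumes "u \<in> neighbors E v"
  shows "level v \<le> Suc (level u)" "level u \<le> Suc (level v)"
  using assms level_edge[of u v] level_edge[of v u] by (auto simp: neighbors_def insert_commute)

lemma ex_predecessor:
  assumes "v \<in> V" "v \<noteq> r"
  obtains u where "u \<in> neighbors E v" "Suc (level u) = level v"
proof -
  obtain l where l: "level v = Suc l"
    using assms level_eq_0 not0_implies_Suc by blast
  with reach_level[OF assms(1)] obtain u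
    where u: "(r, u) \<in> {(x, y). {x, y} \<in> E} ^^ l" and e: "{u, v} \<in> E"
    by auto
  have "level u \<le> l" using u by (rule level_le)
  with level_edge[OF e] l have "Suc (level u) = level v" by simp
  moreover have "u \<in> neighbors E v" using e by (simp add: neighbors_def insert_commute)
  ultimately show thesis using that by blast
qed

lemma layer_subset: "layer k \<subseteq> V"
  by (auto simp: layer_def)

lemma finite_layer [simp]: "finite (layer k)"
  using finite_subset[OF layer_subset] by simp

lemma finite_ball [simp]: "finite (ball k)"
  by (simp add: ball_def)

lemma ball_0: "ball 0 = {r}"
  using level_eq_0 root_in by (auto simp: ball_def)

lemma ball_Suc: "ball (Suc k) = ball k \<union> layer (Suc k)"
  by (auto simp: ball_def layer_def)

lemma card_ball_Suc: "card (ball (Suc k)) = card (ball k) + card (layer (Suc k))"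
  unfolding ball_Suc by (rule card_Un_disjoint) (auto simp: ball_def layer_def)

lemma root_in_ball: "r \<in> ball k"
  using root_in by (simp add: ball_def)

lemma card_ball_pos: "card (ball k) > 0"
  using root_in_ball by (auto simp: card_gt_0_iff)

lemma card_ball_le: "card (ball k) \<le> card V"
  by (rule card_mono) (auto simp: ball_def)

text \<open>Stepping to predecessors lowers the level by exactly one each time, so a walk towards
  the root cannot jump over an empty layer.\<close>

lemma layer_empty_upward:
  assumes "layer k = {}" "v \<in> V" shows "level v < k"
proof (rule ccontr)
  assume "\<not> level v < k"
  then have "\<exists>w\<in>V. level w = k"
    using assms(2)
  proof (induction "level v" arbitrary: v rule: less_induct)
    case less
    show ?case
    proof (cases "level v = k")
      case False
      then have "v \<noteq> r" using less.prems by auto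
      then obtain u where u: "u \<in> neighbors E v" "Suc (level u) = level v"
        using ex_predecessor less.prems by blast
      moreover have "u \<in> V" using u(1) neighbors_subset by blast
      ultimately show ?thesis using less.hyps[of u] False less.prems by auto
    qed (use less.prems in auto)
  qed
  with assms(1) show False by (auto simp: layer_def)
qed

lemma ex_layer_empty: "\<exists>k\<ge>1. layer k = {}"
proof -
  have "layer (Suc (Max (level ` V))) = {}"
    using Max_ge[of "level ` V"] by (fastforce simp: layer_def)
  then show ?thesis by (metis One_nat_def Suc_le_mono le0)
qed

lemma ball_all: "layer k = {} \<Longrightarrow> ball k = V"
  using layer_empty_upward by (force simp: ball_def)

section \<open>Volume growth\<close>

lemma degree_pos:
  assumes "v \<in> V" "V \<noteq> {r}" shows "degree E v > 0"
proof -
  have "neighbors E v \<noteq> {}"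
  proof (cases "v = r")
    case False
    then show ?thesis using ex_predecessor assms by blast
  next
    case True
    obtain w where w: "w \<in> V" "w \<noteq> r" using assms root_in by blast
    have "(r, w) \<in> {(x, y). {x, y} \<in> E}\<^sup>*"
      using connected w root_in unfolding connected_graph_def by blast
    with w obtain y where "{r, y} \<in> E" by (auto elim: converse_rtranclE)
    with True show ?thesis by (auto simp: neighbors_def)
  qed
  then show ?thesis by (simp add: degree_def card_gt_0_iff)
qed

text \<open>Every cut edge of \<open>S\<close> is already counted in the volume of \<open>S - X\<close>.\<close>

lemma vol_add_cut_le:
  assumes "S \<subseteq> V" "X \<subseteq> S" "\<And>v. v \<in> X \<Longrightarrow> neighbors E v \<subseteq> S"
  shows "vol E X + card (cut_edges V E S) \<le> vol E S"
proof -
  have fin: "finite S" using assms(1) finite_subset finite_V by blast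
  have "cut_edges V E S \<subseteq> (\<lambda>(u, v). {u, v}) ` (SIGMA u:S - X. neighbors E u)"
    using assms(3) by (fastforce simp: cut_edges_def neighbors_def)
  then have "card (cut_edges V E S) \<le> card (SIGMA u:S - X. neighbors E u)"
    using fin by (intro surj_card_le) auto
  also have "\<dots> = vol E (S - X)"
    using fin by (simp add: vol_def degree_def)
  finally show ?thesis
    using sum.subset_diff[OF assms(2) fin, of "degree E"] by (simp add: vol_def)
qed

lemma vol_contract:
  assumes \<Phi>: "conductance V E \<ge> ereal \<Phi>"
    and S: "S \<noteq> {}" "S \<subset> V" "vol E S \<le> vol E (V - S)"
    and X: "X \<subseteq> S" "\<And>v. v \<in> X \<Longrightarrow> neighbors E v \<subseteq> S"
  shows "real (vol E X) \<le> (1 - \<Phi>) * real (vol E S)"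
proof -
  have fin: "finite S" using S(2) finite_subset finite_V by blast
  \<comment> \<open>A second vertex makes all degrees positive. Hence \<open>cond V E S\<close> is a
    true quotient and not the default value 0 of a division by zero.\<close>
  have "V \<noteq> {r}" using S by auto
  with S(1,2) degree_pos fin have pos: "vol E S > 0"
    by (fastforce simp: vol_def intro!: sum_pos)
  have "conductance V E \<le> ereal (cond V E S)"
    unfolding conductance_def using S by (intro INF_lower) auto
  with \<Phi> have "ereal \<Phi> \<le> ereal (cond V E S)" by (rule order_trans)
  then have "\<Phi> * real (vol E S) \<le> real (card (cut_edges V E S))"
    using pos by (simp add: cond_def field_simps)
  moreover have "vol E X + card (cut_edges V E S) \<le> vol E S"
    using vol_add_cut_le S(2) X by blast
  ultimately show ?thesis by (simp add: algebra_simps)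
qed

lemma vol_mono: "A \<subseteq> B \<Longrightarrow> B \<subseteq> V \<Longrightarrow> vol E A \<le> vol E B"
  unfolding vol_def by (rule sum_mono2) (auto intro: finite_subset)

text \<open>As long as a ball has at most half of the total volume, the volume of the balls grows by a
  factor \<open>1/(1 - \<Phi>)\<close> per level; afterwards the volume of the complement shrinks by \<open>1 - \<Phi>\<close>.\<close>

lemma ball_growth:
  assumes \<Phi>: "conductance V E \<ge> ereal \<Phi>" "0 \<le> \<Phi>" "\<Phi> \<le> 1"
    and "layer (Suc j) \<noteq> {}"
  shows "1 \<le> (1 - \<Phi>) ^ (j - 1) * (real (vol E (ball j)))\<^sup>2"
proof -
  define q where "q = 1 - \<Phi>"
  define b where "b i = real (vol E (ball i))" for i
  define c where "c i = real (vol E (V - ball i))" for i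
  have q: "0 \<le> q" "q \<le> 1" using \<Phi> by (auto simp: q_def)
  have sub: "ball i \<subseteq> V" for i by (auto simp: ball_def)
  have proper: "ball i \<subset> V" if "i \<le> j" for i
  proof -
    obtain v where v: "v \<in> V" "level v = Suc j" using assms(4) by (auto simp: layer_def)
    with that have "v \<notin> ball i" by (simp add: ball_def)
    with v(1) sub show ?thesis by blast
  qed
  have deg: "degree E v \<ge> 1" if "v \<in> V" for v
    using degree_pos[OF that] proper[of 0] by (auto simp: ball_0 Suc_le_eq)
  have b_mono: "b i \<le> b (Suc i)" for i
    unfolding b_def by (intro of_nat_mono vol_mono[OF _ sub]) (simp add: ball_Suc)
  have b0: "1 \<le> b 0"
    using deg root_in by (simp add: b_def ball_0 vol_def)
  have b1: "1 \<le> b i" for i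
    using b_mono b0 by (induction i) (auto intro: order_trans)
  have cpos: "1 \<le> c j"
  proof -
    obtain v where "v \<in> V - ball j" using proper[of j] by blast
    then have "degree E v \<le> vol E (V - ball j)"
      unfolding vol_def by (intro member_le_sum) auto
    with deg[of v] \<open>v \<in> V - ball j\<close> show ?thesis by (simp add: c_def)
  qed
  have grow: "b i \<le> q * b (Suc i)" if "Suc i \<le> j" "b (Suc i) \<le> c (Suc i)" for i
    unfolding b_def q_def
  proof (rule vol_contract[OF \<Phi>(1)])
    show "ball (Suc i) \<noteq> {}" using root_in_ball by blast
    show "ball (Suc i) \<subset> V" using proper that by blast
    show "vol E (ball (Suc i)) \<le> vol E (V - ball (Suc i))"
      using that by (simp add: b_def c_def)
    show "ball i \<subseteq> ball (Suc i)" by (simp add: ball_Suc)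
    show "neighbors E v \<subseteq> ball (Suc i)" if "v \<in> ball i" for v
      using that level_neighbor neighbors_subset unfolding ball_def
      by (fastforce intro: le_trans)
  qed
  have decay: "c (Suc i) \<le> q * c i" if "i \<le> j" "c i \<le> b i" for i
    unfolding c_def q_def
  proof (rule vol_contract[OF \<Phi>(1)])
    show "V - ball i \<noteq> {}" using proper[OF that(1)] by blast
    show "V - ball i \<subset> V" using root_in_ball root_in by blast
    show "vol E (V - ball i) \<le> vol E (V - (V - ball i))"
      using that sub[of i] by (simp add: b_def c_def double_diff)
    show "V - ball (Suc i) \<subseteq> V - ball i" by (auto simp: ball_Suc)
    show "neighbors E v \<subseteq> V - ball i" if v: "v \<in> V - ball (Suc i)" for v
    proof
      fix u assume u: "u \<in> neighbors E v"
      then show "u \<in> V - ball i"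
        using level_neighbor(1)[OF u] neighbors_subset[of v] v by (auto simp: ball_def)
    qed
  qed
  \<comment> \<open>Before half of the total volume is passed, \<open>grow\<close> maintains the
    first alternative. At the crossing, \<open>c < b\<close>, and multiplying the growth bound by
    \<open>b\<close> produces the square. The crossing step gains no factor \<open>q\<close>, hence
    the exponent \<open>i - 1\<close>. Afterwards \<open>decay\<close> supplies the factors.\<close>
  have "(b i \<le> c i \<and> 1 \<le> q ^ i * b i) \<or> (c i < b i \<and> c i \<le> q ^ (i - 1) * (b i)\<^sup>2)"
    if "i \<le> j" for i
    using that
  proof (induction i)
    case 0
    have "b 0 \<le> (b 0)\<^sup>2" using b0 by (intro self_le_power) auto
    with b0 show ?case by (cases "b 0 \<le> c 0") simp_all
  next
    case (Suc i)
    have sq: "(b i)\<^sup>2 \<le> (b (Suc i))\<^sup>2"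
      using b_mono[of i] b1[of i] by (intro power_mono) auto
    show ?case
    proof (cases "c i < b i")
      case True
      then have IH: "c i \<le> q ^ (i - 1) * (b i)\<^sup>2" using Suc by auto
      have le: "c (Suc i) \<le> q * c i" using decay True Suc.prems by simp
      have "c i \<ge> 0" by (simp add: c_def)
      then have "q * c i \<le> 1 * c i" using q by (intro mult_right_mono) auto
      with le b_mono[of i] True have lt: "c (Suc i) < b (Suc i)" by simp
      have "q * c i \<le> q * (q ^ (i - 1) * (b i)\<^sup>2)"
        using IH q by (intro mult_left_mono) auto
      \<comment> \<open>For \<open>i = 0\<close> the exponent \<open>i - 1\<close> is truncated, and
        the surplus factor \<open>q\<close> is dropped because \<open>q \<le> 1\<close>.\<close>
      also have "\<dots> \<le> q ^ i * (b i)\<^sup>2"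
        using q by (cases i) (auto simp: mult_left_le_one_le)
      also have "\<dots> \<le> q ^ i * (b (Suc i))\<^sup>2"
        using sq q by (intro mult_left_mono) auto
      finally show ?thesis using le lt by simp
    next
      case False
      then have IH: "1 \<le> q ^ i * b i" using Suc by auto
      show ?thesis
      proof (cases "b (Suc i) \<le> c (Suc i)")
        case True
        then have "q ^ i * b i \<le> q ^ i * (q * b (Suc i))"
          using grow Suc.prems q by (intro mult_left_mono) auto
        with True IH show ?thesis by (simp add: mult_ac)
      next
        case False
        have "q ^ i * b i \<le> q ^ i * b (Suc i)"
          using b_mono q by (intro mult_left_mono) auto
        with IH have "1 * b (Suc i) \<le> (q ^ i * b (Suc i)) * b (Suc i)"
          using b1[of "Suc i"] by (intro mult_right_mono) auto
        with False show ?thesis by (auto simp: power2_eq_square mult_ac)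
      qed
    qed
  qed
  from this[of j] consider "1 \<le> q ^ j * b j" | "c j \<le> q ^ (j - 1) * (b j)\<^sup>2" by auto
  then have "1 \<le> q ^ (j - 1) * (b j)\<^sup>2"
  proof cases
    case 1
    also have "q ^ j * b j \<le> q ^ (j - 1) * (b j)\<^sup>2"
    proof (rule mult_mono)
      show "q ^ j \<le> q ^ (j - 1)" using q by (intro power_decreasing) auto
      show "b j \<le> (b j)\<^sup>2" using b1 by (intro self_le_power) auto
    qed (use q b1[of j] in auto)
    finally show ?thesis .
  qed (use cpos in simp)
  then show ?thesis by (simp add: q_def b_def)
qed

text \<open>The marked vertex learns vertex counts but no volumes. Neighbors lie at most one level
  further out, so the next ball bounds every degree in this one.\<close>

lemma vol_ball_le: "vol E (ball j) \<le> (card (ball (Suc j)))\<^sup>2"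
proof -
  have "degree E v \<le> card (ball (Suc j))" if "v \<in> ball j" for v
    unfolding degree_def
  proof (rule card_mono)
    show "neighbors E v \<subseteq> ball (Suc j)"
      using that level_neighbor neighbors_subset unfolding ball_def
      by (fastforce intro: le_trans)
  qed simp
  then have "vol E (ball j) \<le> card (ball j) * card (ball (Suc j))"
    unfolding vol_def using sum_bounded_above[of "ball j" "degree E"] by simp
  also have "\<dots> \<le> card (ball (Suc j)) * card (ball (Suc j))"
    by (simp add: card_ball_Suc)
  finally show ?thesis by (simp add: power2_eq_square)
qed

text \<open>The fourth power arises by squaring twice: \<open>ball_growth\<close> squares a volume,
  and \<open>vol_ball_le\<close> bounds a volume by a squared count. Passing from \<open>d\<close>
  to the volume one level below costs one exponent, crossing half of the volume the other.\<close>

lemma card_ball_growth: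
  assumes \<Phi>: "conductance V E \<ge> ereal \<Phi>" "0 \<le> \<Phi>" "\<Phi> \<le> 1"
    and "layer d \<noteq> {}"
  shows "1 \<le> real (card (ball d)) ^ 4 * (1 - \<Phi>) ^ (d - 2)"
proof (cases d)
  case 0
  then show ?thesis by (simp add: ball_0)
next
  case (Suc j)
  have "1 \<le> (1 - \<Phi>) ^ (j - 1) * (real (vol E (ball j)))\<^sup>2"
    using ball_growth assms Suc by blast
  also have "\<dots> \<le> (1 - \<Phi>) ^ (j - 1) * (real ((card (ball d))\<^sup>2))\<^sup>2"
    using vol_ball_le[of j] \<Phi> Suc
    by (intro mult_left_mono power_mono of_nat_mono) auto
  finally show ?thesis by (simp add: Suc mult.commute flip: power_mult)
qed

text \<open>Without isolated vertices, the edges cover \<open>V\<close>. This turns bounds in the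
  number of vertices into bounds in the number of edges.\<close>

lemma card_verts_le: assumes "V \<noteq> {r}" shows "card V \<le> 2 * card E"
proof -
  have E2: "card e = 2" if "e \<in> E" for e using simple that by (auto simp: simple_graph_def)
  have "E \<subseteq> Pow V" using simple by (auto simp: simple_graph_def)
  then have "finite E" by (rule finite_subset) simp
  have "V \<subseteq> \<Union>E"
  proof
    fix v assume "v \<in> V"
    then have "neighbors E v \<noteq> {}"
      using degree_pos[OF _ assms] by (force simp: degree_def)
    then show "v \<in> \<Union>E" by (auto simp: neighbors_def)
  qed
  then have "card V \<le> card (\<Union>E)"
    using \<open>E \<subseteq> Pow V\<close> by (intro card_mono finite_subset[of "\<Union>E" V]) auto
  also have "\<dots> \<le> sum card E" by (rule card_Union_le_sum_card)
  also have "\<dots> = 2 * card E" using E2 by simp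
  finally show ?thesis .
qed

end

section \<open>The algorithm\<close>

fun bits :: "nat \<Rightarrow> bool list" where
  "bits n = (if n = 0 then [] else odd n # bits (n div 2))"

declare bits.simps [simp del]

primrec bits_value :: "bool list \<Rightarrow> nat" where
  "bits_value [] = 0"
| "bits_value (b # bs) = of_bool b + 2 * bits_value bs"

lemma bits_value_bits [simp]: "bits_value (bits n) = n"
proof (induction n rule: bits.induct)
  case (1 n)
  then show ?case by (subst bits.simps) (auto simp: odd_iff_mod_2_eq_one)
qed

lemma power_length_bits: "0 < n \<Longrightarrow> 2 ^ length (bits n) \<le> 2 * n"
proof (induction n rule: bits.induct)
  case (1 n)
  have len: "length (bits n) = Suc (length (bits (n div 2)))"
    using "1.prems" by (subst bits.simps) simp
  show ?case
  proof (cases "n div 2 = 0")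
    case True
    have "length (bits n) = 1" unfolding len True by (simp add: bits.simps)
    with "1.prems" show ?thesis by simp
  next
    case False
    then have "2 ^ length (bits (n div 2)) \<le> 2 * (n div 2)" using 1 by simp
    then show ?thesis by (simp add: len)
  qed
qed

section \<open>Messages, states and local rules\<close>

datatype msg = Silent | Run nat | Stop nat

text \<open>The tag bit also separates \<open>Run 0\<close> from silence, since
  \<open>bits 0\<close> is empty.\<close>

primrec encode_msg :: "msg \<Rightarrow> bool list" where
  "encode_msg Silent = []"
| "encode_msg (Run x) = True # bits x"
| "encode_msg (Stop k) = False # bits k"

fun decode_msg :: "bool list \<Rightarrow> msg" where
  "decode_msg [] = Silent"
| "decode_msg (b # bs) = (if b then Run (bits_value bs) else Stop (bits_value bs))"

lemma decode_encode_msg [simp]: "decode_msg (encode_msg m) = m"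
  by (cases m) auto

primrec run_count :: "msg \<Rightarrow> nat" where
  "run_count Silent = 0"
| "run_count (Run x) = x"
| "run_count (Stop k) = 0"

text \<open>The arguments are \<open>Asleep degree\<close>, \<open>Active degree parent_port just_woken count\<close>,
  \<open>Leader degree clock vertices_counted\<close>. In \<open>Announce\<close> and \<open>Done\<close>, the number is \<open>n\<close>, or \<open>0\<close> for a
  rejection.\<close>

datatype state =
  Asleep nat
| Active nat nat bool nat
| Leader nat nat nat
| Announce nat
| Done nat

instance state :: countable
  by countable_datatype

text \<open>A vertex woken up at time \<open>t\<close> wakes up its neighbors at time \<open>t + 2\<close> only, so that the stop
  wave, which advances by one level per round, catches up with the breadth-first search.\<close>

fun outgoing :: "state \<Rightarrow> nat \<Rightarrow> msg" where
  "outgoing (Asleep d) i = Silent"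
| "outgoing (Active d p fresh x) i = (if i = p then Run x else if fresh then Silent else Run 0)"
| "outgoing (Leader d t m) i = (if t = 0 then Silent else Run 0)"
| "outgoing (Announce k) i = Stop k"
| "outgoing (Done k) i = Silent"

definition running_ports :: "nat \<Rightarrow> (nat \<Rightarrow> msg) \<Rightarrow> nat set" where
  "running_ports d f = {i \<in> {1..d}. \<exists>x. f i = Run x}"

definition stops :: "nat \<Rightarrow> (nat \<Rightarrow> msg) \<Rightarrow> nat set" where
  "stops d f = {k. \<exists>i\<in>{1..d}. f i = Stop k}"

definition total :: "nat \<Rightarrow> (nat \<Rightarrow> msg) \<Rightarrow> nat" where
  "total d f = (\<Sum>i\<in>{1..d}. run_count (f i))"

text \<open>With \<open>q = 1 - \<Phi>\<close> this is the negation of the conclusion of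
  \<open>card_ball_growth\<close>; for a nonempty layer \<open>d\<close> it certifies that the
  conductance is below \<Phi>.\<close>

definition too_small :: "real \<Rightarrow> nat \<Rightarrow> nat \<Rightarrow> bool" where
  "too_small q m d \<longleftrightarrow> real m ^ 4 * q ^ (d - 2) < 1"

text \<open>Layer counts reach the leader only at multiples of 3, so it decides only then. Emptiness
  is tested before \<open>too_small\<close>, so a complete count is never rejected. The code 0 for a
  rejection is free because every count is positive.\<close>

fun step :: "real \<Rightarrow> state \<Rightarrow> (nat \<Rightarrow> msg) \<Rightarrow> state" where
  "step q (Asleep d) f =
     (if running_ports d f = {} then Asleep d else Active d (Min (running_ports d f)) True 1)"
| "step q (Active d p fresh x) f =
     (if stops d f = {} then Active d p False (total d f) else Announce (Min (stops d f)))"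
| "step q (Leader d t m) f =
     (if 3 dvd Suc t \<and> total d f = 0 then Announce m
      else if 3 dvd Suc t \<and> too_small q (m + total d f) (Suc t div 3) then Announce 0
      else Leader d (Suc t) (m + total d f))"
| "step q (Announce k) f = Done k"
| "step q (Done k) f = Done k"

fun state_verdict :: "state \<Rightarrow> verdict option" where
  "state_verdict (Announce k) = Some (if k = 0 then Reject else Count k)"
| "state_verdict (Done k) = Some (if k = 0 then Reject else Count k)"
| "state_verdict _ = None"

definition counting :: "real \<Rightarrow> algorithm" where
  "counting q = \<lparr>
     init = \<lambda>_ d b. to_nat (if b then Leader d 0 1 else Asleep d),
     send = \<lambda>s i. encode_msg (outgoing (from_nat s) i),
     receive = \<lambda>s f. to_nat (step q (from_nat s) (decode_msg \<circ> f)),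
     verdict = \<lambda>s. state_verdict (from_nat s)\<rparr>"

lemma counting_simps [simp]:
  "init (counting q) x d b = to_nat (if b then Leader d 0 1 else Asleep d)"
  "send (counting q) s i = encode_msg (outgoing (from_nat s) i)"
  "receive (counting q) s f = to_nat (step q (from_nat s) (decode_msg \<circ> f))"
  "verdict (counting q) s = state_verdict (from_nat s)"
  by (simp_all add: counting_def)

lemma idle_Asleep: "idle (counting q) d (to_nat (Asleep e))"
  by (simp add: idle_def running_ports_def)

lemma idle_Done: "idle (counting q) d (to_nat (Done k))"
  by (simp add: idle_def)

lemma initiated_by_marked_counting: "initiated_by_marked (counting q)"
  unfolding initiated_by_marked_def using idle_Asleep by simp

lemma irrevocable_counting: "irrevocable (counting q) N"
proof -
  have "state_verdict s = Some x \<Longrightarrow> state_verdict (step q s f) = Some x" for s x f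
    by (cases s) auto
  then show ?thesis by (simp add: irrevocable_def)
qed

section \<open>The course of a run\<close>

locale counting_run =
  fixes N :: network and a :: nat and q :: real
  assumes valid: "valid_network a N"
begin

abbreviation "V \<equiv> verts N"
abbreviation "E \<equiv> edges N"
abbreviation "r \<equiv> marked N"

sublocale rooted_graph V E r
  using valid by unfold_locales (auto simp: valid_network_def)

section \<open>The breadth-first tree and its descendants\<close>

definition parent_port :: "nat \<Rightarrow> nat" where
  "parent_port v = Min {i \<in> {1..deg N v}. Suc (level (port N v i)) = level v}"

definition parent :: "nat \<Rightarrow> nat" where
  "parent v = port N v (parent_port v)"

definition children :: "nat \<Rightarrow> nat set" where
  "children v = {u \<in> V. u \<noteq> r \<and> parent u = v}"

text \<open>The condition on levels keeps the iterated \<open>parent\<close> from going beyond the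
  root, where its value is arbitrary.\<close>

definition descendants :: "nat \<Rightarrow> nat \<Rightarrow> nat set" where
  "descendants v k = {w \<in> V. level w = level v + k \<and> (parent ^^ k) w = v}"

definition back_port :: "nat \<Rightarrow> nat \<Rightarrow> nat" where
  "back_port v i = (let u = port N v i in inv_into {1..deg N u} (port N u) v)"

lemma port_bij: "v \<in> V \<Longrightarrow> bij_betw (port N v) {1..deg N v} (neighbors E v)"
  using valid by (simp add: valid_network_def)

lemma port_neighbor: "v \<in> V \<Longrightarrow> i \<in> {1..deg N v} \<Longrightarrow> port N v i \<in> neighbors E v"
  by (rule bij_betw_apply[OF port_bij])

lemma port_in: "v \<in> V \<Longrightarrow> i \<in> {1..deg N v} \<Longrightarrow> port N v i \<in> V"
  using port_neighbor neighbors_subset by blast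

lemma neighbor_port:
  assumes "v \<in> V" "u \<in> neighbors E v" obtains i where "i \<in> {1..deg N v}" "port N v i = u"
proof -
  have "u \<in> port N v ` {1..deg N v}"
    using bij_betw_imp_surj_on[OF port_bij[OF assms(1)]] assms(2) by simp
  then show thesis using that by (elim imageE) simp
qed

lemma back_port:
  assumes "v \<in> V" "i \<in> {1..deg N v}"
  shows "back_port v i \<in> {1..deg N (port N v i)}" "port N (port N v i) (back_port v i) = v"
proof -
  let ?u = "port N v i"
  have "v \<in> port N ?u ` {1..deg N ?u}"
    using port_bij[OF port_in[OF assms]] port_neighbor[OF assms] neighbors_sym
    by (auto simp: bij_betw_def)
  then show "back_port v i \<in> {1..deg N ?u}" "port N ?u (back_port v i) = v"
    unfolding back_port_def Let_def by (rule inv_into_into, rule f_inv_into_f)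
qed

lemma parent_port:
  assumes "v \<in> V" "v \<noteq> r"
  shows "parent_port v \<in> {1..deg N v}" "Suc (level (parent v)) = level v"
proof -
  let ?I = "{i \<in> {1..deg N v}. Suc (level (port N v i)) = level v}"
  obtain u where u: "u \<in> neighbors E v" "Suc (level u) = level v"
    using ex_predecessor[OF assms] .
  obtain i where "i \<in> {1..deg N v}" "port N v i = u"
    using neighbor_port[OF assms(1) u(1)] .
  with u have "i \<in> ?I" by simp
  then have "?I \<noteq> {}" by blast
  then have "parent_port v \<in> ?I" unfolding parent_port_def by (intro Min_in) auto
  then show "parent_port v \<in> {1..deg N v}" "Suc (level (parent v)) = level v"
    by (auto simp: parent_def)
qed

lemma parent_neighbor: "v \<in> V \<Longrightarrow> v \<noteq> r \<Longrightarrow> parent v \<in> neighbors E v"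
  unfolding parent_def by (intro port_neighbor parent_port)

lemma parent_in: "v \<in> V \<Longrightarrow> v \<noteq> r \<Longrightarrow> parent v \<in> V"
  by (rule subsetD[OF neighbors_subset parent_neighbor])

text \<open>A vertex sends its count through its parent port only. Injectivity of the port numbering
  shows that the count is heard by the parent and by no other neighbor.\<close>

lemma back_port_eq_parent_port:
  assumes "v \<in> V" "i \<in> {1..deg N v}" "port N v i \<noteq> r"
  shows "back_port v i = parent_port (port N v i) \<longleftrightarrow> parent (port N v i) = v"
proof -
  let ?u = "port N v i"
  have "?u \<in> V" using assms port_in by blast
  then have "inj_on (port N ?u) {1..deg N ?u}" "parent_port ?u \<in> {1..deg N ?u}"
    using port_bij parent_port assms(3) by (auto simp: bij_betw_def)
  then show ?thesis
    using back_port[OF assms(1,2)] unfolding parent_def inj_on_def by metis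
qed

lemma children_neighbors: "children v \<subseteq> neighbors E v"
proof
  fix u assume "u \<in> children v"
  then have "v \<in> neighbors E u" using parent_neighbor[of u] by (auto simp: children_def)
  then show "u \<in> neighbors E v" by (subst neighbors_sym)
qed

lemma level_children: "u \<in> children v \<Longrightarrow> level u = Suc (level v)"
  using parent_port(2)[of u] by (auto simp: children_def)

lemma descendants_0: "v \<in> V \<Longrightarrow> descendants v 0 = {v}"
  by (auto simp: descendants_def)

lemma descendants_subset: "descendants v k \<subseteq> V"
  by (auto simp: descendants_def)

lemma card_descendants_le: "card (descendants v k) \<le> card V"
  by (simp add: card_mono descendants_subset)

lemma ancestor:
  assumes "w \<in> V" "k \<le> level w"
  shows "(parent ^^ k) w \<in> V \<and> level ((parent ^^ k) w) + k = level w"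
  using assms(2)
proof (induction k)
  case (Suc k)
  then have IH: "(parent ^^ k) w \<in> V" "level ((parent ^^ k) w) + k = level w" by auto
  then have "(parent ^^ k) w \<noteq> r" using Suc.prems by auto
  then show ?case using IH parent_in parent_port(2)[of "(parent ^^ k) w"] by simp
qed (use assms in simp)

lemma descendants_root: "descendants r k = layer k"
proof -
  have "(parent ^^ k) w = r" if "w \<in> V" "level w = k" for w
    using ancestor[OF that(1), of k] that(2) level_eq_0[of "(parent ^^ k) w"] by simp
  then show ?thesis unfolding descendants_def layer_def level_root by force
qed

lemma descendants_Suc: "descendants v (Suc k) = (\<Union>u\<in>children v. descendants u k)"
proof
  show "descendants v (Suc k) \<subseteq> (\<Union>u\<in>children v. descendants u k)"
  proof
    fix w assume w: "w \<in> descendants v (Suc k)"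
    let ?u = "(parent ^^ k) w"
    have "?u \<in> V" "level ?u + k = level w"
      using ancestor[of w k] w by (auto simp: descendants_def)
    moreover from this w have "?u \<noteq> r" by (auto simp: descendants_def)
    ultimately show "w \<in> (\<Union>u\<in>children v. descendants u k)"
      using w by (auto simp: descendants_def children_def)
  qed
  show "(\<Union>u\<in>children v. descendants u k) \<subseteq> descendants v (Suc k)"
    using level_children by (fastforce simp: descendants_def children_def)
qed

lemma card_descendants_Suc:
  "card (descendants v (Suc k)) = (\<Sum>u\<in>children v. card (descendants u k))"
  unfolding descendants_Suc
proof (rule card_UN_disjoint)
  show "finite (children v)" using children_neighbors finite_neighbors finite_subset by blast
qed (auto simp: descendants_def)

text \<open>The count of a level \<open>k\<close> below \<open>v\<close> starts at time \<open>2 (level v + k)\<close> and arrives at \<open>v\<close> at time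
  \<open>2 level v + 3 k\<close>; hence counts of different levels do not mix.\<close>

definition carried :: "nat \<Rightarrow> nat \<Rightarrow> nat" where
  "carried v t = (if 2 * level v \<le> t \<and> 3 dvd (t - 2 * level v)
     then card (descendants v ((t - 2 * level v) div 3)) else 0)"

lemma sum_carried:
  assumes "2 * level v \<le> t"
  shows "(\<Sum>u\<in>children v. carried u t) = carried v (Suc t)"
proof -
  obtain s where s: "t = 2 * level v + s" using assms le_Suc_ex by blast
  show ?thesis
  proof (cases "s < 2")
    \<comment> \<open>Children wake up two rounds after \<open>v\<close>, so none has anything to
      report yet. From the third round on, the next case shifts a count by one level and three
      rounds.\<close>
    case True
    then have "carried u t = 0" if "u \<in> children v" for u
      using level_children[OF that] s by (simp add: carried_def)
    moreover have "\<not> 3 dvd Suc s" using True by presburger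
    ultimately show ?thesis using s by (simp add: carried_def)
  next
    case False
    then obtain s' where s': "s = s' + 2" by (metis add.commute le_Suc_ex not_less)
    have "carried u t = (if 3 dvd s' then card (descendants u (s' div 3)) else 0)"
      if "u \<in> children v" for u
      using level_children[OF that] s s' by (simp add: carried_def)
    moreover have "carried v (Suc t) =
        (if 3 dvd s' then card (descendants v (Suc (s' div 3))) else 0)"
    proof -
      have "Suc t - 2 * level v = s' + 3" using s s' by simp
      then show ?thesis using s s' by (simp add: carried_def)
    qed
    ultimately show ?thesis by (simp add: card_descendants_Suc)
  qed
qed

section \<open>Stopping time and predicted run\<close>

definition stop_level :: nat where
  "stop_level = (LEAST d. 1 \<le> d \<and> (layer d = {} \<or> too_small q (card (ball d)) d))"

definition stop_time :: nat where
  "stop_time = 3 * stop_level"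

definition result :: nat where
  "result = (if layer stop_level = {} then card V else 0)"

lemma stop_level:
  "1 \<le> stop_level" "layer stop_level = {} \<or> too_small q (card (ball stop_level)) stop_level"
proof -
  have "\<exists>d. 1 \<le> d \<and> (layer d = {} \<or> too_small q (card (ball d)) d)"
    using ex_layer_empty by blast
  from LeastI_ex[OF this]
  show "1 \<le> stop_level" "layer stop_level = {} \<or> too_small q (card (ball stop_level)) stop_level"
    unfolding stop_level_def by auto
qed

lemma before_stop_level:
  "1 \<le> d \<Longrightarrow> d < stop_level \<Longrightarrow> layer d \<noteq> {} \<and> \<not> too_small q (card (ball d)) d"
  unfolding stop_level_def using not_less_Least by blast

lemma stop_time_ge: "3 \<le> stop_time"
  using stop_level by (simp add: stop_time_def)

text \<open>The breadth-first search and the stop wave meet at level \<open>stop_time\<close>; farther vertices are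
  never reached.\<close>

definition config :: "nat \<Rightarrow> nat \<Rightarrow> state" where
  "config t v =
     (if t < 2 * level v \<or> stop_time \<le> level v then Asleep (deg N v)
      else if t < stop_time + level v then
        (if v = r then Leader (deg N v) t (card (ball (t div 3)))
         else Active (deg N v) (parent_port v) (t = 2 * level v) (carried v t))
      else if t = stop_time + level v then Announce result
      else Done result)"

definition inbox :: "nat \<Rightarrow> nat \<Rightarrow> nat \<Rightarrow> msg" where
  "inbox t v i = (if i \<in> {1..deg N v} then outgoing (config t (port N v i)) (back_port v i) else Silent)"

section \<open>What a vertex receives in the predicted run\<close>

lemma run_count_inbox:
  assumes v: "v \<in> V" and i: "i \<in> {1..deg N v}" and t: "t < stop_time + level (port N v i)"
  shows "run_count (inbox t v i) = (if port N v i \<in> children v then carried (port N v i) t else 0)"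
proof (cases "port N v i = r")
  case True
  then show ?thesis using t i by (auto simp: inbox_def config_def children_def)
next
  case False
  \<comment> \<open>This covers all sleeping neighbors: if \<open>stop_time \<le> level u\<close>,
    then \<open>t < stop_time + level u\<close> also gives \<open>t < 2 * level u\<close>.\<close>
  have "carried (port N v i) t = 0" if "t < 2 * level (port N v i)"
    using that by (simp add: carried_def)
  then show ?thesis
    using t i False back_port_eq_parent_port[OF v i False] port_in[OF v i]
    by (auto simp: inbox_def config_def children_def)
qed

lemma total_inbox:
  assumes v: "v \<in> V" and t: "\<And>u. u \<in> neighbors E v \<Longrightarrow> t < stop_time + level u"
    and "2 * level v \<le> t"
  shows "total (deg N v) (inbox t v) = carried v (Suc t)"
proof -
  have "total (deg N v) (inbox t v) =
      (\<Sum>i\<in>{1..deg N v}. if port N v i \<in> children v then carried (port N v i) t else 0)"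
    unfolding total_def using run_count_inbox[OF v] t port_neighbor[OF v] by (intro sum.cong) auto
  also have "\<dots> = (\<Sum>u\<in>neighbors E v. if u \<in> children v then carried u t else 0)"
    using port_bij[OF v] by (rule sum.reindex_bij_betw)
  also have "\<dots> = (\<Sum>u\<in>children v. carried u t)"
    using children_neighbors[of v] by (simp add: sum.If_cases Int_absorb1)
  finally show ?thesis using sum_carried[OF assms(3)] by simp
qed

lemma carried_root: "carried r t = (if 3 dvd t then card (layer (t div 3)) else 0)"
  by (simp add: carried_def descendants_root)

lemma neighbor_level:
  assumes "v \<in> V" "i \<in> {1..deg N v}"
  shows "level v \<le> Suc (level (port N v i))" "level (port N v i) \<le> Suc (level v)"
  using port_neighbor[OF assms] level_neighbor by blast+

text \<open>The stop wave is at level \<open>l\<close> at time \<open>stop_time + l\<close>, and no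
  neighbor is more than one level closer to the root.\<close>

lemma no_stops:
  assumes "v \<in> V" "Suc t < stop_time + level v"
  shows "stops (deg N v) (inbox t v) = {}"
proof -
  have "inbox t v i \<noteq> Stop k" if i: "i \<in> {1..deg N v}" for i k
    using i assms(2) neighbor_level(1)[OF assms(1) i] by (auto simp: inbox_def config_def)
  then show ?thesis by (auto simp: stops_def)
qed

text \<open>The parent announces exactly one round before \<open>v\<close>, and all announcements
  carry the same number, so the \<open>Min\<close> in \<open>step\<close> makes no real
  choice.\<close>

lemma stops_at_stop:
  assumes "v \<in> V" "v \<noteq> r" "level v < stop_time" "Suc t = stop_time + level v"
  shows "stops (deg N v) (inbox t v) = {result}"
proof -
  have "k = result" if "i \<in> {1..deg N v}" "inbox t v i = Stop k" for i k
    using that by (auto simp: inbox_def config_def split: if_splits)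
  moreover have "inbox t v (parent_port v) = Stop result"
    using parent_port[OF assms(1,2)] assms(3,4)
    by (auto simp: inbox_def config_def parent_def)
  moreover have "parent_port v \<in> {1..deg N v}" using assms parent_port by blast
  ultimately have "k \<in> stops (deg N v) (inbox t v) \<longleftrightarrow> k = result" for k
    unfolding stops_def by blast
  then show ?thesis by blast
qed

lemma no_running_ports:
  assumes v: "v \<in> V" and t: "Suc t < 2 * level v \<or> stop_time \<le> level v"
  shows "running_ports (deg N v) (inbox t v) = {}"
proof -
  have "inbox t v i \<noteq> Run x" if i: "i \<in> {1..deg N v}" for i x
  proof
    let ?u = "port N v i"
    assume "inbox t v i = Run x"
    then have "outgoing (config t ?u) (back_port v i) = Run x" using i by (simp add: inbox_def)
    then have u: "2 * level ?u \<le> t" "level ?u < stop_time" "t < stop_time + level ?u"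
      and send: "?u \<noteq> r \<Longrightarrow> back_port v i = parent_port ?u \<or> t \<noteq> 2 * level ?u"
        "?u = r \<Longrightarrow> t \<noteq> 0"
      by (auto simp: config_def split: if_splits)
    have lu: "level v \<le> Suc (level ?u)" using neighbor_level(1)[OF v i] .
    \<comment> \<open>Both alternatives for \<open>v\<close> force its neighbor to have just woken
      up. Such a vertex speaks only to its parent, which lies closer to the root than
      \<open>v\<close>; the root is silent at time 0.\<close>
    with u t have t': "t = 2 * level ?u" "level v = Suc (level ?u)" by auto
    show False
    proof (cases "?u = r")
      case True
      then show False using t' send by simp
    next
      case False
      then have "parent ?u = v" using send t' back_port_eq_parent_port[OF v i False] by blast
      then show False using parent_port(2)[OF port_in[OF v i] False] t' by simp
    qed
  qed
  then show ?thesis by (auto simp: running_ports_def)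
qed

text \<open>Only neighbors one level closer are awake. They woke one round earlier and by now send
  through all ports, and the stop wave has not passed them. These are the ports over which
  \<open>parent_port\<close> takes its minimum, as \<open>step\<close> does.\<close>

lemma running_ports_wake:
  assumes v: "v \<in> V" "v \<noteq> r" and t: "Suc t = 2 * level v" "level v < stop_time"
  shows "running_ports (deg N v) (inbox t v) =
    {i \<in> {1..deg N v}. Suc (level (port N v i)) = level v}"
proof -
  have "(\<exists>x. inbox t v i = Run x) \<longleftrightarrow> Suc (level (port N v i)) = level v"
    if i: "i \<in> {1..deg N v}" for i
  proof
    assume "\<exists>x. inbox t v i = Run x"
    then have "2 * level (port N v i) \<le> t"
      using i by (auto simp: inbox_def config_def split: if_splits)
    then show "Suc (level (port N v i)) = level v"
      using neighbor_level(1)[OF v(1) i] t by simp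
  next
    assume "Suc (level (port N v i)) = level v"
    then have "t = Suc (2 * level (port N v i))" "Suc (level (port N v i)) < stop_time"
      using t by auto
    then show "\<exists>x. inbox t v i = Run x"
      using i by (auto simp: inbox_def config_def)
  qed
  then show ?thesis by (auto simp: running_ports_def)
qed

section \<open>The predicted run obeys the local rules\<close>

lemma leader_step:
  assumes "t < stop_time"
  shows "step q (config t r) (inbox t r) = config (Suc t) r"
proof -
  have total: "total (deg N r) (inbox t r) = carried r (Suc t)"
    using assms root_in by (intro total_inbox) auto
  \<comment> \<open>The count grows only when \<open>Suc t\<close> is a multiple of 3, and then by
    exactly the next layer.\<close>
  have ball: "card (ball (t div 3)) + carried r (Suc t) = card (ball (Suc t div 3))"
  proof (cases "3 dvd Suc t")
    case True
    then have "Suc t div 3 = Suc (t div 3)" by presburger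
    with True show ?thesis by (simp add: carried_root card_ball_Suc)
  next
    case False
    then have "Suc t div 3 = t div 3" by presburger
    with False show ?thesis by (simp add: carried_root)
  qed
  have conf: "config t r = Leader (deg N r) t (card (ball (t div 3)))"
    using assms by (simp add: config_def)
  show ?thesis
  proof (cases "Suc t = stop_time")
    case True
    then have d: "3 dvd Suc t" "Suc t div 3 = stop_level" by (simp_all add: stop_time_def)
    have conf': "config (Suc t) r = Announce result" using True by (simp add: config_def)
    show ?thesis
    proof (cases "layer stop_level = {}")
      case True
      then have "card (ball (t div 3)) = card V"
        using ball ball_all d by (simp add: carried_root)
      with True show ?thesis
        using conf conf' total d by (simp add: carried_root result_def)
    next
      case False
      with stop_level have "too_small q (card (ball stop_level)) stop_level" by blast
      with False show ?thesis
        using conf conf' total d ball by (simp add: carried_root result_def)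
    qed
  next
    case False
    with assms have lt: "Suc t < stop_time" by simp
    have conf': "config (Suc t) r = Leader (deg N r) (Suc t) (card (ball (Suc t div 3)))"
      using lt by (simp add: config_def)
    show ?thesis
    proof (cases "3 dvd Suc t")
      case True
      then have "1 \<le> Suc t div 3" "Suc t div 3 < stop_level"
        using lt by (auto simp: stop_time_def elim!: dvdE)
      then have "layer (Suc t div 3) \<noteq> {}"
        "\<not> too_small q (card (ball (Suc t div 3))) (Suc t div 3)"
        using before_stop_level by auto
      then show ?thesis using conf conf' total ball True by (simp add: carried_root)
    qed (use conf conf' total ball in simp)
  qed
qed

lemma config_step:
  assumes v: "v \<in> V"
  shows "step q (config t v) (inbox t v) = config (Suc t) v"
proof -
  \<comment> \<open>The cases follow the life of a vertex: asleep, waking, leading, counting, being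
    stopped, finished.\<close>
  consider "Suc t < 2 * level v \<or> stop_time \<le> level v"
    | "Suc t = 2 * level v" "level v < stop_time"
    | "2 * level v \<le> t" "level v < stop_time" "t < stop_time + level v" "v = r"
    | "2 * level v \<le> t" "level v < stop_time" "Suc t < stop_time + level v" "v \<noteq> r"
    | "2 * level v \<le> t" "level v < stop_time" "Suc t = stop_time + level v" "v \<noteq> r"
    | "2 * level v \<le> t" "level v < stop_time" "stop_time + level v \<le> t"
    by linarith
  then show ?thesis
  proof cases
    case 1
    then show ?thesis using no_running_ports[OF v 1] by (auto simp: config_def)
  next
    case 2
    then have "v \<noteq> r" by auto
    let ?I = "{i \<in> {1..deg N v}. Suc (level (port N v i)) = level v}"
    have ports: "running_ports (deg N v) (inbox t v) = ?I"
      using running_ports_wake 2 v \<open>v \<noteq> r\<close> by blast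
    have "Min (running_ports (deg N v) (inbox t v)) = parent_port v"
      unfolding ports parent_port_def ..
    moreover have "parent_port v \<in> ?I" using parent_port[OF v \<open>v \<noteq> r\<close>] by (simp add: parent_def)
    then have "running_ports (deg N v) (inbox t v) \<noteq> {}" unfolding ports by blast
    moreover have "carried v (Suc t) = 1" using 2 v by (simp add: carried_def descendants_0)
    ultimately show ?thesis
      using 2 \<open>v \<noteq> r\<close> by (simp add: config_def)
  next
    case 3
    then show ?thesis using leader_step by simp
  next
    case 4
    have "t < stop_time + level u" if "u \<in> neighbors E v" for u
      using level_neighbor(1)[OF that] 4 by simp
    then have "total (deg N v) (inbox t v) = carried v (Suc t)"
      using total_inbox 4 v by blast
    then show ?thesis using 4 no_stops[OF v] by (simp add: config_def)
  next
    case 5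
    then show ?thesis using stops_at_stop[OF v] by (simp add: config_def)
  next
    case 6
    then show ?thesis by (auto simp: config_def)
  qed
qed

text \<open>The closed form \<open>config\<close> has the right initial values and satisfies the
  recursion of \<open>run\<close>, by \<open>config_step\<close>.\<close>

lemma run_counting: "v \<in> V \<Longrightarrow> run (counting q) N t v = to_nat (config t v)"
proof (induction t arbitrary: v)
  case 0
  then show ?case
    using level_eq_0[of v] stop_time_ge by (auto simp: config_def ball_0)
next
  case (Suc t)
  let ?f = "\<lambda>i. if i \<in> {1..deg N v}
          then let u = port N v i
               in send (counting q) (run (counting q) N t u) (inv_into {1..deg N u} (port N u) v)
          else []"
  have "decode_msg \<circ> ?f = inbox t v"
  proof
    fix i
    show "(decode_msg \<circ> ?f) i = inbox t v i"
      using Suc.IH[OF port_in[OF Suc.prems]]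
      by (simp add: inbox_def back_port_def Let_def)
  qed
  moreover have "run (counting q) N (Suc t) v =
      to_nat (step q (from_nat (run (counting q) N t v)) (decode_msg \<circ> ?f))"
    by simp
  ultimately have "run (counting q) N (Suc t) v = to_nat (step q (config t v) (inbox t v))"
    using Suc.IH[OF Suc.prems] by simp
  then show ?case using config_step[OF Suc.prems] by simp
qed

section \<open>Termination and outcome\<close>

lemma verdict_counting:
  "v \<in> V \<Longrightarrow> verdict (counting q) (run (counting q) N t v) = state_verdict (config t v)"
  by (simp add: run_counting)

text \<open>A vertex below level \<open>stop_time\<close> announces before time
  \<open>2 * stop_time\<close>; all others sleep forever.\<close>

lemma config_final: "config (Suc (2 * stop_time)) v =
    (if stop_time \<le> level v then Asleep (deg N v) else Done result)"
  by (simp add: config_def)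

lemma terminated_counting: "terminated (counting q) N (Suc (2 * stop_time))"
  by (simp add: terminated_def run_counting config_final idle_Asleep idle_Done del: run.simps)

lemma rounds_le: "rounds (counting q) N \<le> Suc (2 * stop_time)"
  unfolding rounds_def using terminated_counting by (rule Least_le)

lemma computes_n_counting:
  assumes "layer stop_level = {}"
  shows "computes_n (counting q) N"
proof -
  have "level v < stop_time" if "v \<in> V" for v
    using layer_empty_upward[OF assms that] by (simp add: stop_time_def)
  moreover have "V \<noteq> {}" using root_in by blast
  ultimately have "verdict (counting q) (run (counting q) N (Suc (2 * stop_time)) v) =
      Some (Count (card V))" if "v \<in> V" for v
    using that assms by (simp add: verdict_counting config_final result_def not_le del: run.simps counting_simps)
  then show ?thesis using terminated_counting unfolding computes_n_def by blast
qed

lemma rejects_counting: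
  assumes "layer stop_level \<noteq> {}"
  shows "rejects (counting q) N"
proof -
  have "verdict (counting q) (run (counting q) N (Suc (2 * stop_time)) r) = Some Reject"
    using assms root_in stop_time_ge by (simp add: verdict_counting config_final result_def del: run.simps counting_simps)
  then show ?thesis using terminated_counting unfolding rejects_def by blast
qed

section \<open>Length of messages\<close>

lemma message_bound_counting: "message_bound 3 (counting q) N"
  unfolding message_bound_def
proof (intro allI ballI)
  fix t v i
  assume v: "v \<in> V" and i: "i \<in> {1..deg N v}"
  let ?n = "card V" and ?m = "outgoing (config t v) i"
  \<comment> \<open>A vertex with a port has a neighbor, so there are two vertices and the logarithm
    is at least 1.\<close>
  have "V \<noteq> {r}"
  proof
    assume "V = {r}"
    have "u \<notin> neighbors E v" for u
      using edge_in[of v u] \<open>V = {r}\<close> by (auto simp: neighbors_def)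
    then have "neighbors E v = {}" by blast
    with i show False by (simp add: degree_def)
  qed
  with root_in obtain w where "w \<in> V" "w \<noteq> r" by blast
  then have n: "2 \<le> ?n"
    using card_mono[of V "{r, w}"] root_in by simp
  have bits: "real (Suc (length (bits x))) \<le> 3 * log 2 (real ?n)" if "x \<le> ?n" for x
  proof -
    have "2 ^ length (bits x) \<le> 2 * ?n"
      using power_length_bits[of x] that n by (cases "x = 0") (auto simp: bits.simps[of 0])
    then have "2 ^ Suc (length (bits x)) \<le> 2 * 2 * ?n" by simp
    \<comment> \<open>Since \<open>4 \<le> ?n * ?n\<close>, the tag bit and the rounding are
      absorbed by a cube, whence the constant 3.\<close>
    also have "\<dots> \<le> ?n * ?n * ?n" using n by (intro mult_mono) auto
    finally have "2 ^ Suc (length (bits x)) \<le> ?n ^ 3" by (simp add: power3_eq_cube)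
    then have "real (2 ^ Suc (length (bits x))) \<le> real (?n ^ 3)" by (rule of_nat_mono)
    then have "2 ^ Suc (length (bits x)) \<le> real ?n ^ 3" by simp
    then have "log 2 (2 ^ Suc (length (bits x))) \<le> log 2 (real ?n ^ 3)"
      using n by (subst log_le_cancel_iff) auto
    then show ?thesis using n by (simp add: log_nat_power del: power_Suc)
  qed
  have result: "result \<le> ?n" by (simp add: result_def)
  have carried: "carried v t \<le> ?n" by (simp add: carried_def card_descendants_le)
  have "?m \<in> {Silent, Run 0, Run (carried v t), Stop result}"
    by (simp add: config_def)
  then have "real (length (encode_msg ?m)) \<le> 3 * log 2 (real ?n)"
    using bits[of 0] bits[of "carried v t"] bits[of result] carried result n by auto
  then show "real (length (send (counting q) (run (counting q) N t v) i)) \<le> 3 * log 2 (real ?n)"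
    using run_counting[OF v] by simp
qed

section \<open>Soundness of the rejection and number of rounds\<close>

lemma conductance_layer_stop_level:
  assumes "conductance V E \<ge> ereal (1 - q)" "0 \<le> q" "q \<le> 1"
  shows "layer stop_level = {}"
proof (rule ccontr)
  assume ne: "layer stop_level \<noteq> {}"
  with stop_level have "too_small q (card (ball stop_level)) stop_level" by blast
  moreover have "1 \<le> real (card (ball stop_level)) ^ 4 * (1 - (1 - q)) ^ (stop_level - 2)"
    using assms ne by (intro card_ball_growth) auto
  ultimately show False by (simp add: too_small_def)
qed

lemma stop_level_le:
  assumes "0 < q" "q < 1" "card E \<ge> 2"
  shows "real stop_level \<le> 3 + 8 * (ln (real (card E)) / \<bar>ln q\<bar>)"
proof (cases "stop_level \<le> 3")
  case True
  moreover have "ln (real (card E)) \<ge> 0" using assms by simp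
  ultimately show ?thesis by (simp add: add_increasing2)
next
  case False
  define k where "k = stop_level - 3"
  let ?m = "real (card E)" and ?s = "real (card (ball (stop_level - 1)))"
  have lnq: "ln q < 0" using assms by simp
  \<comment> \<open>The test did not succeed one level earlier, and its exponent there is
    \<open>stop_level - 1 - 2 = k\<close>.\<close>
  have "\<not> too_small q (card (ball (stop_level - 1))) (stop_level - 1)"
    using before_stop_level[of "stop_level - 1"] False by simp
  then have "1 \<le> ?s ^ 4 * q ^ k" by (simp add: too_small_def k_def numeral_3_eq_3)
  then have "0 \<le> ln (?s ^ 4 * q ^ k)" by simp
  also have "\<dots> = 4 * ln ?s + real k * ln q"
    using root_in_ball[of "stop_level - 1"] assms(1)
    by (subst ln_mult) (auto simp: ln_realpow)
  finally have le: "real k * \<bar>ln q\<bar> \<le> 4 * ln ?s" using lnq by simp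
  have "card V \<le> 2 * card E"
  proof (rule card_verts_le)
    show "V \<noteq> {r}"
    proof
      assume "V = {r}"
      have "card e \<le> 1" if "e \<in> E" for e
        using card_mono[of "{r}" e] simple that \<open>V = {r}\<close> by (simp add: simple_graph_def)
      then have "E = {}" using simple by (force simp: simple_graph_def)
      with assms show False by simp
    qed
  qed
  \<comment> \<open>Bounding \<open>2 * card E\<close> by a square avoids an additive constant in
    the logarithm. With the fourth power, the exponent 2 gives the factor 8.\<close>
  then have "card (ball (stop_level - 1)) \<le> card E * card E"
    using card_ball_le[of "stop_level - 1"] assms(3)
    by (meson le_trans mult_le_mono1)
  then have "?s \<le> real (card E * card E)" by (rule of_nat_mono)
  then have "ln ?s \<le> ln (?m * ?m)"
    using card_ball_pos assms(3) by (subst ln_le_cancel_iff) auto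
  also have "\<dots> = 2 * ln ?m" using assms(3) by (subst ln_mult) auto
  finally have "real k * \<bar>ln q\<bar> \<le> 8 * ln ?m" using le by simp
  then have "real k \<le> 8 * ln ?m / \<bar>ln q\<bar>" using lnq by (subst pos_le_divide_eq) auto
  then show ?thesis using False by (simp add: k_def)
qed

end

theorem lemma3p10:
  fixes a :: nat
  shows "\<exists>(C::real) (c::real). \<forall>\<Phi>::real. 0 \<le> \<Phi> \<and> \<Phi> \<le> 1 \<longrightarrow>
    (\<exists>A. initiated_by_marked A \<and>
      (\<forall>N. valid_network a N \<longrightarrow>
         message_bound c A N \<and> irrevocable A N \<and>
         (conductance (verts N) (edges N) \<ge> ereal \<Phi> \<longrightarrow> computes_n A N) \<and>
         (\<not> conductance (verts N) (edges N) \<ge> ereal \<Phi> \<longrightarrow> computes_n A N \<or> rejects A N)) \<and>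
      (0 < \<Phi> \<and> \<Phi> < 1 \<longrightarrow>
         (\<exists>m0::nat. \<forall>N. valid_network a N \<and> m0 \<le> card (edges N) \<longrightarrow>
            real (rounds A N) \<le> C * (ln (real (card (edges N))) / \<bar>ln (1 - \<Phi>)\<bar>))))"
proof (intro exI allI impI conjI)
  fix \<Phi> :: real assume \<Phi>: "0 \<le> \<Phi> \<and> \<Phi> \<le> 1"
  let ?A = "counting (1 - \<Phi>)"
  show "initiated_by_marked ?A" by (rule initiated_by_marked_counting)
  {
    fix N assume "valid_network a N"
    then interpret counting_run N a "1 - \<Phi>" by unfold_locales
    show "message_bound 3 ?A N" by (rule message_bound_counting)
    show "irrevocable ?A N" by (rule irrevocable_counting)
    show "computes_n ?A N" if "conductance (verts N) (edges N) \<ge> ereal \<Phi>"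
      using that \<Phi> by (intro computes_n_counting conductance_layer_stop_level) auto
    show "computes_n ?A N \<or> rejects ?A N"
      using computes_n_counting rejects_counting by blast
  }
  assume "0 < \<Phi> \<and> \<Phi> < 1"
  then have q: "0 < 1 - \<Phi>" "1 - \<Phi> < 1" by auto
  then have L: "\<bar>ln (1 - \<Phi>)\<bar> > 0" by simp
  \<comment> \<open>This threshold ensures \<open>1 \<le> x\<close>, so that additive constants can
    be absorbed, and the two edges that \<open>stop_level_le\<close> asks for. It depends on \<Phi>,
    whereas the constant 67 does not.\<close>
  define m0 where "m0 = max 2 (nat \<lceil>exp (\<bar>ln (1 - \<Phi>)\<bar>)\<rceil>)"
  fix N :: network assume "valid_network a N \<and> m0 \<le> card (edges N)"
  then have valid: "valid_network a N" and m: "m0 \<le> card (edges N)" by auto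
  interpret counting_run N a "1 - \<Phi>" using valid by unfold_locales
  define x where "x = ln (real (card E)) / \<bar>ln (1 - \<Phi>)\<bar>"
  have m2: "card E \<ge> 2" and "exp \<bar>ln (1 - \<Phi>)\<bar> \<le> real (card E)"
    using m by (auto simp: m0_def nat_le_iff ceiling_le_iff)
  then have "\<bar>ln (1 - \<Phi>)\<bar> \<le> ln (real (card E))"
    by (subst ln_ge_iff) auto
  then have x: "1 \<le> x" using L by (simp add: x_def)
  have "real (rounds ?A N) \<le> 1 + 6 * real stop_level"
    using rounds_le by (simp add: stop_time_def)
  also have "\<dots> \<le> 1 + 6 * (3 + 8 * x)"
    using stop_level_le[OF q m2] by (simp add: x_def)
  \<comment> \<open>The left side is \<open>19 + 48 * x\<close>.\<close>
  also have "\<dots> \<le> 67 * x" using x by simp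
  finally show "real (rounds ?A N) \<le> 67 * (ln (real (card (edges N))) / \<bar>ln (1 - \<Phi>)\<bar>)"
    by (simp add: x_def)
qed

end
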